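(* Let $m,n\in\mathbb{N}$ and let $\mathcal{A}=(a_{p_1\dots p_m})\in\mathbb{S}_{m,n}$. Then $\mathcal{A}\in GDD^+_{m,n}$ if and only if $\mathbb{F}(\mathcal{A})\ne\emptyset$, where $\mathbb{F}(\mathcal{A})$ is the set of all families of real numbers $(d^{\vec{i}}_j)_{\vec{i}\in\mathscr{D}_n^m,\ j\in\vec{i}}$ such that $$a_{jj\dots j}\ \ge\ \sum_{\vec{i}\in\mathscr{D}_n^m:\ j\in\vec{i}} d^{\vec{i}}_j\quad\text{for all } j\in[n],$$ $$\bigl(d^{\vec{i}}_{i_1},\dots,d^{\vec{i}}_{i_m},\,c(\vec{i})^{1/m}a_{\vec{i}}\bigr)\in\mathbb{K}^{(m)}_{\frac1m e}\quad\text{for all }\vec{i}=(i_1,\dots,i_m)\in\mathscr{D}_n^m.$$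
   Context: $\mathbb{S}_{m,n}$ is the set of real symmetric tensors $\mathcal{A}=(a_{i_1\dots i_m})$ of order $m$ and dimension $n$ (indices in $[n]=\{1,\dots,n\}$, entries invariant under permutations of the indices). The diagonal elements are the entries $a_{ii\dots i}$. A tensor $\mathcal{A}$ is diagonally dominant (DD) if $|a_{ii\dots i}|\ge\sum_{(i_2,\dots,i_m)\ne(i,\dots,i)}|a_{ii_2\dots i_m}|$ for all $i\in[n]$. It is generalized diagonally dominant (GDD) if there is a diagonal matrix $D$ with positive diagonal entries $d_1,\dots,d_n$ such that the tensor with entries $a_{i_1\dots i_m}d_{i_1}^{1-m}d_{i_2}\cdots d_{i_m}$ is DD. A GDD$^+$ tensor is a GDD tensor with nonnegative diagonal elements; $GDD^+_{m,n}$ is the set of GDD$^+$ tensors in $\mathbb{S}_{m,n}$. (Symmetric $H^+$-tensors are exactly the elements of $GDD^+_{m,n}$.) $\mathscr{D}_n^m$ is the set of $\vec{i}=(i_1,\dots,i_m)$ with $1\le i_1\le\cdots\le i_m\le n$ that are not all equal; $j\in\vec{i}$ means $j\in\{i_1,\dots,i_m\}$; $a_{\vec{i}}=a_{i_1\dots i_m}$. For $\vec{i}\in\mathscr{D}_n^m$ let $j_1<\dots<j_l$ be the distinct values among $i_1,\dots,i_m$, let $\alpha_k$ be the multiplicity of $j_k$, and $\alpha^{\vec{i}}=(\alpha_1,\dots,\alpha_l)$. Then $c(\vec{i})=\prod_{k=1}^{l}\binom{m-1}{\alpha^{\vec{i}}-e_k}^{\alpha_k}$, where $e_k$ is the $k$-th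 standard unit vector of $\mathbb{R}^l$ and $\binom{m-1}{\beta}=\frac{(m-1)!}{\beta_1!\cdots\beta_l!}$ is the multinomial coefficient. For $\alpha\in\mathbb{R}^m_+$ with $\sum_k\alpha_k=1$, the high-dimensional power cone is $\mathbb{K}^{(m)}_\alpha=\{(x,z)\in\mathbb{R}^m_+\times\mathbb{R}: x_1^{\alpha_1}\cdots x_m^{\alpha_m}\ge|z|\}$; $e$ is the all-ones vector. *)

theory Defs
  imports "HOL-Analysis.Analysis" "HOL-Combinatorics.Permutations"
begin

(* A real tensor of order m and dimension n is a function on index lists, of which only the values
   on index_tuples m n (lists of length m over {1..n}) are meaningful.  Every predicate below
   inspects only those values. *)

definition index_tuples :: "nat \<Rightarrow> nat \<Rightarrow> nat list set" where
  "index_tuples m n = {is. length is = m \<and> set is \<subseteq> {1..n}}"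

definition symmetric_tensors :: "nat \<Rightarrow> nat \<Rightarrow> (nat list \<Rightarrow> real) set" where
  "symmetric_tensors m n =
     {A. \<forall>is \<in> index_tuples m n. \<forall>\<sigma>. \<sigma> permutes {..<m} \<longrightarrow> A (permute_list \<sigma> is) = A is}"

definition diag_entry :: "nat \<Rightarrow> (nat list \<Rightarrow> real) \<Rightarrow> nat \<Rightarrow> real" where
  "diag_entry m A i = A (replicate m i)"

definition DD :: "nat \<Rightarrow> nat \<Rightarrow> (nat list \<Rightarrow> real) \<Rightarrow> bool" where
  "DD m n A \<longleftrightarrow> (\<forall>i \<in> {1..n}.
     \<bar>diag_entry m A i\<bar> \<ge>
       (\<Sum>is \<in> index_tuples (m - 1) n - {replicate (m - 1) i}. \<bar>A (i # is)\<bar>))"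

(* The diagonal matrix D is represented by its diagonal d. *)
definition diag_scaling :: "nat \<Rightarrow> (nat \<Rightarrow> real) \<Rightarrow> (nat list \<Rightarrow> real) \<Rightarrow> nat list \<Rightarrow> real" where
  "diag_scaling m d A is = A is * d (hd is) powi (1 - int m) * prod_list (map d (tl is))"

definition GDD :: "nat \<Rightarrow> nat \<Rightarrow> (nat list \<Rightarrow> real) \<Rightarrow> bool" where
  "GDD m n A \<longleftrightarrow> (\<exists>d. (\<forall>i \<in> {1..n}. d i > 0) \<and> DD m n (diag_scaling m d A))"

definition GDD_plus :: "nat \<Rightarrow> nat \<Rightarrow> (nat list \<Rightarrow> real) set" where
  "GDD_plus m n =
     {A \<in> symmetric_tensors m n. GDD m n A \<and> (\<forall>i \<in> {1..n}. diag_entry m A i \<ge> 0)}"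

definition offdiag_indices :: "nat \<Rightarrow> nat \<Rightarrow> nat list set" where
  "offdiag_indices m n =
     {is \<in> index_tuples m n. sorted is \<and> (\<exists>j \<in> set is. \<exists>k \<in> set is. j \<noteq> k)}"

definition multinomial :: "nat \<Rightarrow> 'a set \<Rightarrow> ('a \<Rightarrow> nat) \<Rightarrow> real" where
  "multinomial N S \<beta> = fact N / (\<Prod>j \<in> S. fact (\<beta> j))"

(* The vector of multiplicities is indexed by the distinct values occurring in the index list
   themselves rather than by their positions 1, ..., l in increasing order.  The natural-number
   subtraction of the unit vector never truncates, since every such value occurs at least once. *)
definition index_coeff :: "nat list \<Rightarrow> real" where
  "index_coeff is =
     (\<Prod>k \<in> set is.
        multinomial (length is - 1) (set is) (\<lambda>j. count_list is j - (if j = k then 1 else 0))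
          ^ count_list is k)"

(* The case split implements the convention 0^0 = 1, whereas 0 powr 0 = 0. *)
definition power_cone :: "real list \<Rightarrow> (real list \<times> real) set" where
  "power_cone \<alpha> =
     {(x, z). length x = length \<alpha> \<and> (\<forall>t \<in> set x. t \<ge> 0) \<and>
        (\<Prod>k < length \<alpha>. if \<alpha> ! k = 0 then 1 else (x ! k) powr (\<alpha> ! k)) \<ge> \<bar>z\<bar>}"

(* Members are families indexed by exactly the pairs (i, j) with j occurring in the off-diagonal
   index i, hence the extensional function spaces. *)
definition feasible_families :: "nat \<Rightarrow> nat \<Rightarrow> (nat list \<Rightarrow> real) \<Rightarrow> (nat list \<Rightarrow> nat \<Rightarrow> real) set" where
  "feasible_families m n A =
     {d \<in> (\<Pi>\<^sub>E is \<in> offdiag_indices m n. \<Pi>\<^sub>E j \<in> set is. UNIV).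
        (\<forall>j \<in> {1..n}.
           diag_entry m A j \<ge> (\<Sum>is \<in> {is \<in> offdiag_indices m n. j \<in> set is}. d is j)) \<and>
        (\<forall>is \<in> offdiag_indices m n.
           (map (d is) is, index_coeff is powr (1 / real m) * A is)
             \<in> power_cone (replicate m (1 / real m)))}"

end

theory Submission
  imports Defs "HOL-Combinatorics.Multiset_Permutations"
begin

text \<open>
  Write \<open>a j\<close> for the diagonal entries, \<open>w\<^sub>i\<^sub>j\<close> (\<open>slice_count\<close>) for the number of rearrangements of a
  sorted index \<open>i\<close> that begin with \<open>j\<close>, and \<open>x\<^sup>i\<close> for the product of the \<open>x j\<close> over the entries \<open>j\<close>
  of \<open>i\<close>. By symmetry, a positive diagonal scaling \<open>x\<close> makes the tensor diagonally dominant iff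
  \<open>\<Sum>i\<ni>j. w\<^sub>i\<^sub>j * \<bar>A i\<bar> * x\<^sup>i \<le> \<bar>a j\<bar> * x j ^ m\<close> for all \<open>j\<close> (\<open>DD_diag_scaling_iff\<close>). The coefficient
  \<open>index_coeff i\<close> is the product of \<open>w\<^sub>i\<^sub>j\<close> over the entries \<open>j\<close> of \<open>i\<close>, so the cone condition on a
  family \<open>d\<close> says that \<open>d\<close> is nonnegative and that the product of the \<open>d i j\<close> over the entries of
  \<open>i\<close> is at least that of the \<open>w\<^sub>i\<^sub>j * \<bar>A i\<bar>\<close> (\<open>power_cone_uniform_iff\<close>).

  From a scaling \<open>x\<close> one obtains the family \<open>d i j = w\<^sub>i\<^sub>j * \<bar>A i\<bar> * x\<^sup>i / x j ^ m\<close>, for which the powers of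
  \<open>x\<close> cancel in the product over the entries of \<open>i\<close>; the cone condition holds with equality.

  Conversely, a family \<open>d\<close> is a certificate of copositivity: by the inequality of arithmetic and
  geometric means (\<open>orbit_monomial_le_sum\<close>), each off-diagonal term of the form of the comparison
  tensor is bounded by \<open>\<Sum>j. d i j * x j ^ m\<close>, and summing over \<open>i\<close> shows that this form is
  nonnegative for \<open>x \<ge> 0\<close>. A scaling then arises as in the Perron-Frobenius theorem
  (\<open>positive_scaling_exists\<close>): where \<open>\<Sum>j. x j ^ m = 1\<close> and \<open>x \<ge> 0\<close>, the form has a minimizer, and if
  it is positive, vanishing derivatives say that its scaled rows are dominant. The minimizer can have
  zeros, but its support is then a union of connected components of the hypergraph of the nonzero
  off-diagonal entries, because otherwise a small perturbation would lower the form; hence the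
  components can be treated separately.
\<close>

section \<open>Positive critical points of copositive forms\<close>

definition monomial :: "'a set \<Rightarrow> ('a \<Rightarrow> nat) \<Rightarrow> ('a \<Rightarrow> real) \<Rightarrow> real" where
  "monomial V p x = (\<Prod>j\<in>V. x j ^ p j)"

lemma monomial_nonneg: "(\<And>j. j \<in> V \<Longrightarrow> x j \<ge> 0) \<Longrightarrow> monomial V p x \<ge> 0"
  by (simp add: monomial_def prod_nonneg)

lemma monomial_scale:
  assumes "sum p V = m"
  shows "monomial V p (\<lambda>j. t * x j) = t ^ m * monomial V p x"
  using assms by (simp add: monomial_def power_mult_distrib prod.distrib flip: power_sum)

lemma monomial_cong_support:
  assumes "finite V" "W \<subseteq> V" "\<And>j. j \<in> V - W \<Longrightarrow> p j = 0" "\<And>j. j \<in> W \<Longrightarrow> x j = y j"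
  shows "monomial V p x = monomial W p y"
proof -
  have "(\<Prod>j\<in>V. x j ^ p j) = (\<Prod>j\<in>W. x j ^ p j)"
    using assms by (intro prod.mono_neutral_right) auto
  also have "\<dots> = (\<Prod>j\<in>W. y j ^ p j)"
    using assms by (intro prod.cong) auto
  finally show ?thesis by (simp add: monomial_def)
qed

text \<open>
  Pinning the coordinates outside \<open>V\<close> to 0 makes a box in finitely many variables compact in the
  full function space, so that the extreme value theorem applies there.
\<close>

lemma compact_coordinate_box:
  fixes V :: "'a set"
  shows "compact {x :: 'a \<Rightarrow> real. \<forall>j. x j \<in> (if j \<in> V then {0..1} else {0})}"
proof -
  have "compactin (product_topology (\<lambda>_. euclidean) UNIV)
          (PiE (UNIV :: 'a set) (\<lambda>j. if j \<in> V then {0..1::real} else {0}))"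
    by (subst compactin_PiE) auto
  moreover have "PiE (UNIV :: 'a set) (\<lambda>j. if j \<in> V then {0..1::real} else {0})
      = {x. \<forall>j. x j \<in> (if j \<in> V then {0..1} else {0})}"
    by (simp only: PiE_UNIV_domain Pi_def) simp
  ultimately show ?thesis
    by (simp add: euclidean_product_topology)
qed

text \<open>
  The exponent vectors \<open>p e\<close> may be read as hyperedges on the vertex set \<open>V\<close> with multiplicities and
  weights \<open>c e\<close>. For the hypergraph of a symmetric tensor, this is the form of its comparison tensor:
  diagonal entries \<open>a j\<close>, all other entries replaced by minus their absolute value.
\<close>

definition diag_minus_tail ::
  "'a set \<Rightarrow> 'e set \<Rightarrow> nat \<Rightarrow> ('a \<Rightarrow> real) \<Rightarrow> ('e \<Rightarrow> real) \<Rightarrow> ('e \<Rightarrow> 'a \<Rightarrow> nat) \<Rightarrow> ('a \<Rightarrow> real) \<Rightarrow> real" where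
  "diag_minus_tail V E m a c p x = (\<Sum>j\<in>V. a j * x j ^ m) - (\<Sum>e\<in>E. c e * monomial V (p e) x)"

text \<open>
  Both the form and \<open>\<Sum>j\<in>V. x j ^ m\<close> are homogeneous of degree \<open>m\<close>, so a minimizer on the compact
  slice where the latter equals 1 minimizes the quotient of the two on the whole orthant. The
  conclusion avoids the quotient, so that it can be differentiated without a constraint.
\<close>

lemma diag_minus_tail_minimizer:
  fixes a :: "'a \<Rightarrow> real"
  assumes V: "finite V" "V \<noteq> {}" and m: "m > 0"
    and deg: "\<And>e. e \<in> E \<Longrightarrow> sum (p e) V = m"
  shows "\<exists>x. (\<forall>j\<in>V. x j \<ge> 0) \<and> (\<Sum>j\<in>V. x j ^ m) = 1 \<and>
    (\<forall>y. (\<forall>j\<in>V. y j \<ge> 0) \<longrightarrow>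
        diag_minus_tail V E m a c p x * (\<Sum>j\<in>V. y j ^ m) \<le> diag_minus_tail V E m a c p y)"
proof -
  let ?G = "diag_minus_tail V E m a c p" and ?N = "\<lambda>x. \<Sum>j\<in>V. x j ^ m"
  define K where "K = {x. \<forall>j. x j \<in> (if j \<in> V then {0..1} else {0::real})} \<inter> {x. ?N x = 1}"
  have cont: "continuous_on X (\<lambda>x. x j)" for X :: "('a \<Rightarrow> real) set" and j
    by (rule continuous_on_subset[OF continuous_on_product_coordinates]) simp
  have "closed {x :: 'a \<Rightarrow> real. ?N x = 1}"
    by (intro closed_Collect_eq continuous_intros cont)
  hence "compact K"
    unfolding K_def by (intro compact_Int_closed compact_coordinate_box)
  moreover have "K \<noteq> {}"
  proof -
    obtain v where v: "v \<in> V" using V by auto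
    have "?N (\<lambda>j. if j = v then 1 else 0 :: real) = (\<Sum>j\<in>V. if j = v then 1 else 0)"
      using m by (intro sum.cong) auto
    hence "(\<lambda>j. if j = v then 1 else 0) \<in> K"
      using v V by (auto simp: K_def)
    thus ?thesis by blast
  qed
  moreover have "continuous_on K ?G"
    unfolding diag_minus_tail_def monomial_def by (intro continuous_intros cont)
  ultimately obtain x where x: "x \<in> K" "\<And>y. y \<in> K \<Longrightarrow> ?G x \<le> ?G y"
    by (metis continuous_attains_inf)
  have scale: "?G (\<lambda>j. t * y j) = t ^ m * ?G y" for t y
    using deg by (simp add: diag_minus_tail_def monomial_scale power_mult_distrib
        sum_distrib_left right_diff_distrib mult_ac)
  have "?G x * ?N y \<le> ?G y" if y: "\<And>j. j \<in> V \<Longrightarrow> y j \<ge> 0" for y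
  proof (cases "?N y = 0")
    case True
    hence "y j = 0" if "j \<in> V" for j
      using that V y m by (subst (asm) sum_nonneg_eq_0_iff) auto
    hence "?G y = ?G (\<lambda>j. 0 * y j)"
      by (simp add: diag_minus_tail_def monomial_def)
    also have "\<dots> = 0" using scale[of 0 y] m by simp
    finally show ?thesis using True by simp
  next
    case False
    moreover have "?N y \<ge> 0" using y by (intro sum_nonneg) auto
    ultimately have pos: "?N y > 0" by simp
    define t where "t = root m (inverse (?N y))"
    have t: "t \<ge> 0" "t ^ m = inverse (?N y)"
      using pos m by (auto simp: t_def)
    define z where "z = (\<lambda>j. if j \<in> V then t * y j else 0)"
    have Gz: "?G z = t ^ m * ?G y"
      by (subst scale[symmetric]) (simp add: diag_minus_tail_def monomial_def z_def)
    have Nz: "?N z = 1"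
    proof -
      have "?N z = (\<Sum>j\<in>V. t ^ m * y j ^ m)"
        by (intro sum.cong) (auto simp: z_def power_mult_distrib)
      also have "\<dots> = t ^ m * ?N y" by (simp add: sum_distrib_left)
      finally show ?thesis using t pos by simp
    qed
    have z0: "z j \<ge> 0" for j using t y by (auto simp: z_def)
    have "z j \<le> 1" if "j \<in> V" for j
    proof -
      have "z j ^ m \<le> ?N z" using that V z0 by (intro member_le_sum) auto
      hence "z j ^ m \<le> 1 ^ m" using Nz by simp
      thus ?thesis using m z0 power_mono_iff[of "z j" 1 m] by simp
    qed
    hence "z \<in> K" using z0 Nz by (auto simp: K_def) (simp add: z_def)
    hence "?G x \<le> inverse (?N y) * ?G y" using x(2) Gz t by metis
    thus ?thesis using pos by (simp add: field_simps)
  qed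
  moreover have "\<And>j. j \<in> V \<Longrightarrow> x j \<ge> 0" "?N x = 1"
    using x(1) by (auto simp: K_def split: if_splits)
  ultimately show ?thesis by blast
qed

text \<open>
  At a positive coordinate the function \<open>diag_minus_tail - l * (\<Sum>j\<in>V. x j ^ m)\<close>, which is
  nonnegative and vanishes at \<open>x\<close>, has a two-sided local minimum, so its partial derivative there
  is 0. This is the eigenvector equation of the comparison tensor, multiplied by \<open>x j\<close> so that no
  exponent is lowered.
\<close>

lemma minimizer_critical:
  fixes a :: "'a \<Rightarrow> real"
  assumes V: "finite V" and m: "m > 0"
    and nn: "\<And>j. j \<in> V \<Longrightarrow> x j \<ge> 0"
    and eq: "diag_minus_tail V E m a c p x = l * (\<Sum>j\<in>V. x j ^ m)"
    and le: "\<And>y. (\<And>j. j \<in> V \<Longrightarrow> y j \<ge> 0) \<Longrightarrow> l * (\<Sum>j\<in>V. y j ^ m) \<le> diag_minus_tail V E m a c p y"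
    and j: "j \<in> V" "x j > 0"
  shows "m * a j * x j ^ m - (\<Sum>e\<in>E. c e * p e j * monomial V (p e) x) = l * m * x j ^ m"
proof -
  define h where "h = (\<lambda>t. diag_minus_tail V E m a c p (x(j := t)) - l * (\<Sum>k\<in>V. (x(j := t)) k ^ m))"
  define R where "R = (\<lambda>e. monomial (V - {j}) (p e) x)"
  have mono: "monomial V (p e) (x(j := t)) = t ^ p e j * R e" for e t
  proof -
    have "monomial V (p e) (x(j := t)) = t ^ p e j * (\<Prod>k\<in>V-{j}. (x(j := t)) k ^ p e k)"
      using V j by (simp add: monomial_def prod.remove)
    also have "(\<Prod>k\<in>V-{j}. (x(j := t)) k ^ p e k) = R e"
      unfolding R_def monomial_def by (intro prod.cong) auto
    finally show ?thesis .
  qed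
  have sums: "(\<Sum>k\<in>V. b k * (x(j := t)) k ^ m) = b j * t ^ m + (\<Sum>k\<in>V-{j}. b k * x k ^ m)" for b t
  proof -
    have "(\<Sum>k\<in>V. b k * (x(j := t)) k ^ m) = b j * t ^ m + (\<Sum>k\<in>V-{j}. b k * (x(j := t)) k ^ m)"
      using V j by (simp add: sum.remove)
    also have "(\<Sum>k\<in>V-{j}. b k * (x(j := t)) k ^ m) = (\<Sum>k\<in>V-{j}. b k * x k ^ m)"
      by (intro sum.cong) auto
    finally show ?thesis .
  qed
  have h: "h = (\<lambda>t. a j * t ^ m + (\<Sum>k\<in>V-{j}. a k * x k ^ m) - (\<Sum>e\<in>E. c e * (t ^ p e j * R e))
            - l * (t ^ m + (\<Sum>k\<in>V-{j}. x k ^ m)))"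
    unfolding h_def diag_minus_tail_def mono sums using sums[of "\<lambda>_. 1"] by simp
  have "(h has_field_derivative a j * (m * x j ^ (m - 1))
        - (\<Sum>e\<in>E. c e * (p e j * x j ^ (p e j - 1) * R e)) - l * (m * x j ^ (m - 1))) (at (x j))"
    unfolding h by (auto intro!: derivative_eq_intros simp: mult_ac)
  moreover have "h (x j) \<le> h t" if "\<bar>x j - t\<bar> < x j" for t
  proof -
    have "t > 0" using that by auto
    hence "0 \<le> h t" unfolding h_def using le[of "x(j := t)"] nn by (simp add: fun_upd_def)
    moreover have "h (x j) = 0" unfolding h_def fun_upd_triv using eq by simp
    ultimately show ?thesis by simp
  qed
  ultimately have "a j * (m * x j ^ (m - 1))
        - (\<Sum>e\<in>E. c e * (p e j * x j ^ (p e j - 1) * R e)) - l * (m * x j ^ (m - 1)) = 0"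
    using j(2) by (blast intro: DERIV_local_min)
  hence "(a j * (m * x j ^ (m - 1))
        - (\<Sum>e\<in>E. c e * (p e j * x j ^ (p e j - 1) * R e)) - l * (m * x j ^ (m - 1))) * x j = 0"
    by simp
  moreover have "x j ^ (m - 1) * x j = x j ^ m"
    using m by (metis power_minus_mult)
  moreover have "c e * (p e j * x j ^ (p e j - 1) * R e) * x j = c e * p e j * monomial V (p e) x" for e
  proof (cases "p e j = 0")
    case False
    hence "x j ^ (p e j - 1) * x j = x j ^ p e j" by (metis power_minus_mult neq0_conv)
    thus ?thesis using mono[of e "x j"] by (simp add: mult_ac)
  qed simp
  ultimately show ?thesis
    by (simp only: left_diff_distrib sum_distrib_right) (simp add: mult_ac)
qed

text \<open>
  A minimizer may vanish somewhere, but only on a union of connected components: raise all vanishing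
  coordinates to a small \<open>t\<close>. The diagonal terms change by a multiple of \<open>t ^ m\<close>. A hyperedge \<open>f\<close>
  joining the support to its complement lowers the form by a positive multiple of \<open>t ^ s\<close>, where \<open>s\<close>
  is the degree of \<open>f\<close> in the vanishing coordinates, and no other hyperedge raises it; as \<open>s < m\<close>, the
  form would drop below its bound.
\<close>

lemma minimizer_support_not_crossed:
  fixes a :: "'a \<Rightarrow> real"
  assumes V: "finite V" and E: "finite E" and m: "m > 0"
    and deg: "\<And>e. e \<in> E \<Longrightarrow> sum (p e) V = m" and c: "\<And>e. e \<in> E \<Longrightarrow> c e \<ge> 0"
    and nn: "\<And>j. j \<in> V \<Longrightarrow> x j \<ge> 0"
    and eq: "diag_minus_tail V E m a c p x = l * (\<Sum>j\<in>V. x j ^ m)"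
    and le: "\<And>y. (\<And>j. j \<in> V \<Longrightarrow> y j \<ge> 0) \<Longrightarrow> l * (\<Sum>j\<in>V. y j ^ m) \<le> diag_minus_tail V E m a c p y"
    and f: "f \<in> E" "c f \<noteq> 0" and j: "j \<in> V" "x j > 0" "p f j > 0" and k: "k \<in> V" "p f k > 0"
  shows "x k > 0"
proof (rule ccontr)
  assume "\<not> x k > 0"
  define T where "T = {i\<in>V. x i = 0}"
  have T: "T \<subseteq> V" "finite T" "k \<in> T" "j \<in> V - T"
    using V k j nn[of k] \<open>\<not> x k > 0\<close> by (auto simp: T_def)
  define y where "y = (\<lambda>(t::real) i. if i \<in> T then t else x i)"
  define s where "s = sum (p f) T"
  define P where "P = (\<Prod>i\<in>V-T. x i ^ p f i)"
  define B where "B = (\<Sum>i\<in>T. a i) - l * card T"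
  have s_less: "s < m"
  proof -
    have "s + p f j \<le> sum (p f) T + sum (p f) (V - T)"
      unfolding s_def using T V by (intro add_left_mono member_le_sum) auto
    also have "\<dots> = m" using deg[OF f(1)] T V by (metis sum.subset_diff add.commute)
    finally show ?thesis using j by simp
  qed
  have P: "P > 0" unfolding P_def
  proof (intro prod_pos ballI)
    fix i assume "i \<in> V - T"
    hence "x i > 0" using nn[of i] by (auto simp: T_def)
    thus "x i ^ p f i > 0" by simp
  qed
  have sums: "(\<Sum>i\<in>V. b i * y t i ^ m) = (\<Sum>i\<in>V. b i * x i ^ m) + t ^ m * sum b T" for b t
  proof -
    have "(\<Sum>i\<in>V. b i * y t i ^ m) = (\<Sum>i\<in>V-T. b i * y t i ^ m) + (\<Sum>i\<in>T. b i * y t i ^ m)"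
      using V T by (meson sum.subset_diff)
    also have "(\<Sum>i\<in>V-T. b i * y t i ^ m) = (\<Sum>i\<in>V. b i * x i ^ m)"
      using V m by (intro sum.mono_neutral_cong_left) (auto simp: y_def T_def)
    also have "(\<Sum>i\<in>T. b i * y t i ^ m) = t ^ m * sum b T"
      by (simp add: y_def sum_distrib_left sum_distrib_right mult_ac)
    finally show ?thesis .
  qed
  have mono_le: "monomial V (p e) x \<le> monomial V (p e) (y t)" if "t \<ge> 0" for e t
    unfolding monomial_def using nn that
    by (intro prod_mono) (auto simp: y_def T_def intro!: power_mono)
  have mono_f: "monomial V (p f) (y t) = P * t ^ s" for t
  proof -
    have "monomial V (p f) (y t) = (\<Prod>i\<in>V-T. y t i ^ p f i) * (\<Prod>i\<in>T. y t i ^ p f i)"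
      unfolding monomial_def using V T by (meson prod.subset_diff)
    thus ?thesis by (simp add: y_def P_def s_def power_sum)
  qed
  have mono_f0: "monomial V (p f) x = 0"
    unfolding monomial_def using V k T(3) by (auto simp: T_def intro!: prod_zero)
  \<comment> \<open>Compare the form at \<open>y t\<close> and at \<open>x\<close>, then cancel \<open>t ^ s\<close>.\<close>
  have ineq: "c f * P \<le> B * t ^ (m - s)" if t: "t > 0" for t
  proof -
    have "(\<Sum>e\<in>E. c e * monomial V (p e) x) + c f * P * t ^ s
            = (\<Sum>e\<in>E - {f}. c e * monomial V (p e) x) + c f * monomial V (p f) (y t)"
      using sum.remove[OF E f(1), of "\<lambda>e. c e * monomial V (p e) x"] mono_f0 mono_f by simp
    also have "\<dots> \<le> (\<Sum>e\<in>E - {f}. c e * monomial V (p e) (y t)) + c f * monomial V (p f) (y t)"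
      using c mono_le t by (intro add_right_mono sum_mono mult_left_mono) auto
    also have "\<dots> = (\<Sum>e\<in>E. c e * monomial V (p e) (y t))"
      using sum.remove[OF E f(1), of "\<lambda>e. c e * monomial V (p e) (y t)"] by simp
    finally have 1: "(\<Sum>e\<in>E. c e * monomial V (p e) x) + c f * P * t ^ s \<le> \<dots>" .
    have "l * (\<Sum>i\<in>V. y t i ^ m) \<le> diag_minus_tail V E m a c p (y t)"
      using nn t by (intro le) (auto simp: y_def)
    also have "\<dots> \<le> diag_minus_tail V E m a c p x + t ^ m * sum a T - c f * P * t ^ s"
      using 1 by (simp add: diag_minus_tail_def sums)
    finally have "c f * P * t ^ s \<le> B * t ^ m"
      using eq sums[of "\<lambda>_. 1" t] by (simp add: B_def algebra_simps)
    also have "t ^ m = t ^ (m - s) * t ^ s"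
      using s_less by (simp flip: power_add)
    finally show ?thesis using t by (simp flip: mult.assoc)
  qed
  \<comment> \<open>This \<open>t\<close> makes \<open>\<bar>B\<bar> * t\<close> at most half of \<open>c f * P\<close>, against \<open>ineq\<close>.\<close>
  define t where "t = min 1 (c f * P / (2 * (\<bar>B\<bar> + 1)))"
  have cP: "c f * P > 0" using c[OF f(1)] f P by simp
  hence t: "t > 0" "t \<le> 1" by (auto simp: t_def)
  have "c f * P \<le> \<bar>B\<bar> * t ^ (m - s)"
    using ineq[OF t(1)] t by (smt (verit) mult_right_mono zero_le_power)
  also have "\<dots> \<le> \<bar>B\<bar> * t ^ 1"
    using t s_less by (intro mult_left_mono power_decreasing) auto
  also have "\<dots> \<le> (\<bar>B\<bar> + 1) * (c f * P / (2 * (\<bar>B\<bar> + 1)))"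
    using t by (intro mult_mono) (auto simp: t_def)
  also have "\<dots> = c f * P / 2" by (simp add: field_simps)
  finally show False using cP by linarith
qed

text \<open>
  The Perron-Frobenius part. If the minimizer is positive everywhere, it is the desired \<open>x\<close>, because
  its minimum value is nonnegative. Otherwise no hyperedge of nonzero weight crosses between its
  support \<open>S\<close> and the complement \<open>T\<close>, so the problem decouples into two smaller ones of the same
  kind, and vectors that solve these can be glued together.
\<close>

lemma positive_scaling_exists:
  fixes a :: "'a \<Rightarrow> real"
  assumes "finite V" and "finite E" and "m > 0"
    and "\<And>e. e \<in> E \<Longrightarrow> sum (p e) V = m" and "\<And>e. e \<in> E \<Longrightarrow> c e \<ge> 0"
    and "\<And>x. (\<And>j. j \<in> V \<Longrightarrow> x j \<ge> 0) \<Longrightarrow> diag_minus_tail V E m a c p x \<ge> 0"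
  shows "\<exists>x. (\<forall>j\<in>V. x j > 0) \<and>
     (\<forall>j\<in>V. (\<Sum>e\<in>E. c e * p e j * monomial V (p e) x) \<le> m * a j * x j ^ m)"
  using assms
proof (induction "card V" arbitrary: V E rule: less_induct)
  case less
  note V = less.prems(1) and E = less.prems(2) and m = less.prems(3)
   and deg = less.prems(4) and c = less.prems(5) and nonneg = less.prems(6)
  show ?case
  proof (cases "V = {}")
    case False
    have "\<exists>u. (\<forall>j\<in>V. u j \<ge> 0) \<and> (\<Sum>j\<in>V. u j ^ m) = 1 \<and>
       (\<forall>y. (\<forall>j\<in>V. y j \<ge> 0) \<longrightarrow>
          diag_minus_tail V E m a c p u * (\<Sum>j\<in>V. y j ^ m) \<le> diag_minus_tail V E m a c p y)"
      by (rule diag_minus_tail_minimizer[OF V False m]) (rule deg)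
    then obtain u where u_nonneg: "\<forall>j\<in>V. u j \<ge> 0" and u_norm: "(\<Sum>j\<in>V. u j ^ m) = 1"
      and u_min: "\<forall>y. (\<forall>j\<in>V. y j \<ge> 0) \<longrightarrow>
          diag_minus_tail V E m a c p u * (\<Sum>j\<in>V. y j ^ m) \<le> diag_minus_tail V E m a c p y"
      by (elim exE conjE)
    define l where "l = diag_minus_tail V E m a c p u"
    have u: "u j \<ge> 0" if "j \<in> V" for j
      using u_nonneg that by blast
    have l_le: "l * (\<Sum>j\<in>V. y j ^ m) \<le> diag_minus_tail V E m a c p y" if "\<And>j. j \<in> V \<Longrightarrow> y j \<ge> 0" for y
      unfolding l_def using u_min that by blast
    have l_eq: "diag_minus_tail V E m a c p u = l * (\<Sum>j\<in>V. u j ^ m)"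
      by (simp add: l_def u_norm)
    have l: "l \<ge> 0"
      unfolding l_def by (rule nonneg) (rule u)
    define S where "S = {j\<in>V. u j > 0}"
    have "S \<noteq> {}"
    proof
      assume "S = {}"
      hence "u j = 0" if "j \<in> V" for j
        using that u[of j] by (force simp: S_def)
      thus False using u_norm m by (simp add: zero_power)
    qed
    show ?thesis
    proof (cases "S = V")
      case True
      have "(\<Sum>e\<in>E. c e * p e j * monomial V (p e) u) \<le> m * a j * u j ^ m" if "j \<in> V" for j
      proof -
        have "u j > 0" using that True by (auto simp: S_def)
        moreover from this have "m * a j * u j ^ m - (\<Sum>e\<in>E. c e * p e j * monomial V (p e) u) = l * m * u j ^ m"
          using that
          by (intro minimizer_critical[OF V m _ l_eq]) (erule u, rule l_le, blast, assumption+)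
        moreover have "l * m * u j ^ m \<ge> 0" using l u[OF that] by simp
        ultimately show ?thesis by simp
      qed
      thus ?thesis using True by (intro exI[of _ u]) (auto simp: S_def)
    next
      case False
      define T where "T = V - S"
      define F where "F = (\<lambda>W. {e\<in>E. \<forall>j\<in>V-W. p e j = 0})"
      \<comment> \<open>\<open>F W\<close> are the hyperedges inside \<open>W\<close>; extension by 0 shows that the form stays nonnegative on \<open>W\<close>.\<close>
      have part: "\<exists>x. (\<forall>j\<in>W. x j > 0) \<and>
         (\<forall>j\<in>W. (\<Sum>e\<in>F W. c e * p e j * monomial W (p e) x) \<le> m * a j * x j ^ m)"
        if W: "W \<subset> V" for W
      proof (rule less.hyps)
        show "card W < card V" using W V by (simp add: psubset_card_mono)
        show "finite W" "finite (F W)" using W V E by (auto simp: F_def finite_subset)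
        show "sum (p e) W = m" if "e \<in> F W" for e
        proof -
          have "sum (p e) W = sum (p e) V"
            using that V W by (intro sum.mono_neutral_left) (auto simp: F_def)
          thus ?thesis using deg that by (auto simp: F_def)
        qed
        show "c e \<ge> 0" if "e \<in> F W" for e using c that by (auto simp: F_def)
        show "diag_minus_tail W (F W) m a c p x \<ge> 0" if x: "\<And>j. j \<in> W \<Longrightarrow> x j \<ge> 0" for x
        proof -
          define y where "y = (\<lambda>j. if j \<in> W then x j else 0)"
          have y: "y j \<ge> 0" for j using x by (auto simp: y_def)
          have "0 \<le> diag_minus_tail V E m a c p y" using y by (intro nonneg)
          also have "\<dots> \<le> diag_minus_tail W (F W) m a c p x"
            unfolding diag_minus_tail_def
          proof (intro diff_mono)
            show "(\<Sum>j\<in>V. a j * y j ^ m) \<le> (\<Sum>j\<in>W. a j * x j ^ m)"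
              using W V m by (intro eq_refl[OF sum.mono_neutral_cong_right]) (auto simp: y_def zero_power)
            have "(\<Sum>e\<in>F W. c e * monomial W (p e) x) = (\<Sum>e\<in>F W. c e * monomial V (p e) y)"
              using W V
              by (intro sum.cong arg_cong2[of _ _ _ _ "(*)"] monomial_cong_support[symmetric])
                (auto simp: F_def y_def)
            also have "\<dots> \<le> (\<Sum>e\<in>E. c e * monomial V (p e) y)"
              using E c y by (intro sum_mono2) (auto simp: F_def monomial_nonneg)
            finally show "(\<Sum>e\<in>F W. c e * monomial W (p e) x) \<le> (\<Sum>e\<in>E. c e * monomial V (p e) y)" .
          qed
          finally show ?thesis .
        qed
      qed (rule m)
      have split: "e \<in> F W" if "W = S \<or> W = T" "j \<in> W" "e \<in> E" "c e * p e j \<noteq> 0" for W e j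
      proof -
        have pj: "p e j > 0" "c e \<noteq> 0" using that by auto
        have cross: "u k > 0" if "i \<in> V" "u i > 0" "p e i > 0" "k \<in> V" "p e k > 0" for i k
          by (rule minimizer_support_not_crossed[OF V E m _ _ _ l_eq _ \<open>e \<in> E\<close> pj(2) that])
            (erule deg, erule c, erule u, rule l_le, blast)
        have "p e k = 0" if "k \<in> V - W" for k
          using cross[of j k] cross[of k j] pj that \<open>W = S \<or> W = T\<close> \<open>j \<in> W\<close>
          by (auto simp: S_def T_def)
        thus ?thesis using that by (auto simp: F_def)
      qed
      have ST: "S \<subset> V" "T \<subset> V" "V = S \<union> T"
        using False \<open>S \<noteq> {}\<close> by (auto simp: T_def S_def)
      obtain v where v: "\<forall>j\<in>S. v j > 0"
        "\<forall>j\<in>S. (\<Sum>e\<in>F S. c e * p e j * monomial S (p e) v) \<le> m * a j * v j ^ m"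
        using part[OF ST(1)] by blast
      obtain w where w: "\<forall>j\<in>T. w j > 0"
        "\<forall>j\<in>T. (\<Sum>e\<in>F T. c e * p e j * monomial T (p e) w) \<le> m * a j * w j ^ m"
        using part[OF ST(2)] by blast
      define x where "x = (\<lambda>j. if j \<in> S then v j else w j)"
      have glue: "(\<Sum>e\<in>E. c e * p e j * monomial V (p e) x) = (\<Sum>e\<in>F W. c e * p e j * monomial W (p e) z)"
        if W: "W = S \<or> W = T" "j \<in> W" and z: "\<And>i. i \<in> W \<Longrightarrow> x i = z i" for W j z
      proof (rule sum.mono_neutral_cong_right)
        show "\<forall>e\<in>E - F W. c e * p e j * monomial V (p e) x = 0"
          using split[OF W] by fastforce
        fix e assume e: "e \<in> F W"
        have "monomial V (p e) x = monomial W (p e) z"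
          using V ST W z e by (intro monomial_cong_support) (auto simp: F_def)
        thus "c e * p e j * monomial V (p e) x = c e * p e j * monomial W (p e) z" by simp
      qed (use E in \<open>auto simp: F_def\<close>)
      have "(\<Sum>e\<in>E. c e * p e j * monomial V (p e) x) \<le> m * a j * x j ^ m" if "j \<in> V" for j
      proof (cases "j \<in> S")
        case True
        thus ?thesis using glue[of S j v] v by (simp add: x_def)
      next
        case False
        hence "j \<in> T" using that by (simp add: T_def)
        moreover have "i \<notin> S" if "i \<in> T" for i using that by (simp add: T_def)
        ultimately show ?thesis using glue[of T j w] w False by (simp add: x_def)
      qed
      moreover have "x j > 0" if "j \<in> V" for j
        using that v(1) w(1) ST(3) by (auto simp: x_def)
      ultimately show ?thesis by blast
    qed
  qed auto
qed

section \<open>Rows of scaled symmetric tensors\<close>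

lemma prod_list_map_count:
  fixes f :: "'a \<Rightarrow> 'b :: comm_monoid_mult"
  assumes "finite S" "set xs \<subseteq> S"
  shows "prod_list (map f xs) = (\<Prod>x\<in>S. f x ^ count_list xs x)"
  using assms(2)
proof (induction xs)
  case (Cons y ys)
  have "(\<Prod>x\<in>S. f x ^ count_list (y # ys) x)
      = (\<Prod>x\<in>S. (if x = y then f x else 1) * f x ^ count_list ys x)"
    by (intro prod.cong) auto
  also have "\<dots> = (\<Prod>x\<in>S. if x = y then f x else 1) * (\<Prod>x\<in>S. f x ^ count_list ys x)"
    by (rule prod.distrib)
  also have "(\<Prod>x\<in>S. if x = y then f x else 1) = f y"
    using Cons.prems assms(1) by simp
  finally show ?case using Cons by simp
qed simp

lemma sum_list_map_count:
  fixes f :: "'a \<Rightarrow> 'b :: semiring_1"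
  assumes "finite S" "set xs \<subseteq> S"
  shows "sum_list (map f xs) = (\<Sum>x\<in>S. of_nat (count_list xs x) * f x)"
  using assms(2)
proof (induction xs)
  case (Cons y ys)
  have "(\<Sum>x\<in>S. of_nat (count_list (y # ys) x) * f x)
      = (\<Sum>x\<in>S. (if x = y then f x else 0) + of_nat (count_list ys x) * f x)"
    by (intro sum.cong) (auto simp: distrib_right)
  also have "\<dots> = (\<Sum>x\<in>S. if x = y then f x else 0) + (\<Sum>x\<in>S. of_nat (count_list ys x) * f x)"
    by (rule sum.distrib)
  also have "(\<Sum>x\<in>S. if x = y then f x else 0) = f y"
    using Cons.prems assms(1) by simp
  finally show ?case using Cons by simp
qed simp

lemma finite_index_tuples: "finite (index_tuples m n)"
  unfolding index_tuples_def
  using finite_lists_length_eq[of "{1..n}" m] by (simp add: conj_commute)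

lemma finite_offdiag_indices: "finite (offdiag_indices m n)"
  unfolding offdiag_indices_def by (simp add: finite_index_tuples)

lemma offdiag_indicesD:
  assumes "is \<in> offdiag_indices m n"
  shows "length is = m" "set is \<subseteq> {1..n}" "sorted is"
  using assms by (auto simp: offdiag_indices_def index_tuples_def)

lemma symmetric_tensor_mset_eq:
  assumes "A \<in> symmetric_tensors m n" "is \<in> index_tuples m n" "mset js = mset is"
  shows "A js = A is"
proof -
  obtain \<sigma> where "\<sigma> permutes {..<length is}" "permute_list \<sigma> is = js"
    using mset_eq_permutation[OF assms(3)] .
  thus ?thesis using assms(1,2) by (auto simp: symmetric_tensors_def index_tuples_def)
qed

text \<open>
  The multinomial factor of \<open>index_coeff\<close> counts the rearrangements of \<open>is\<close> that begin with \<open>k\<close>.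
\<close>

definition slice_count :: "nat list \<Rightarrow> nat \<Rightarrow> real" where
  "slice_count is k =
     multinomial (length is - 1) (set is) (\<lambda>j. count_list is j - (if j = k then 1 else 0))"

lemma slice_count_pos: "slice_count is k > 0"
  by (simp add: slice_count_def multinomial_def prod_pos)

lemma card_slice:
  assumes "j \<in> set is"
  shows "real (card {t. mset (j # t) = mset is}) = slice_count is j"
proof -
  define B where "B = mset is - {#j#}"
  have "{t. mset (j # t) = mset is} = permutations_of_multiset B"
    using assms by (auto simp: permutations_of_multiset_def B_def) (metis add_mset_remove_trivial)
  moreover have "real (card (permutations_of_multiset B)) * (\<Prod>x\<in>set_mset B. fact (count B x)) = fact (size B)"
    using arg_cong[OF card_permutations_of_multiset_aux[of B], of real] by (simp add: of_nat_prod)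
  moreover have "(\<Prod>x\<in>set_mset B. fact (count B x)) = (\<Prod>x\<in>set is. fact (count B x) :: real)"
    by (rule prod.mono_neutral_left) (auto simp: B_def not_in_iff dest: in_diffD)
  moreover have "(\<Prod>x\<in>set is. fact (count B x) :: real) > 0"
    by (intro prod_pos) simp
  moreover have "count B x = count_list is x - (if x = j then 1 else 0)" for x
    by (simp add: B_def count_mset)
  moreover have "size B = length is - 1"
    using assms by (simp add: B_def size_Diff_singleton)
  ultimately show ?thesis
    by (simp add: slice_count_def multinomial_def field_simps)
qed

text \<open>
  The off-diagonal part of row \<open>j\<close>, for entries that depend only on the multiset of indices: sorting
  \<open>j # t\<close> groups the tails \<open>t\<close> by the sorted index to which they belong.
\<close>

lemma sum_slice:
  fixes f :: "nat multiset \<Rightarrow> real"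
  assumes j: "j \<in> {1..n}"
  shows "(\<Sum>t \<in> index_tuples k n - {replicate k j}. f (mset (j # t)))
       = (\<Sum>is \<in> {is \<in> offdiag_indices (Suc k) n. j \<in> set is}. slice_count is j * f (mset is))"
proof -
  let ?T = "index_tuples k n - {replicate k j}"
  let ?I = "{is \<in> offdiag_indices (Suc k) n. j \<in> set is}"
  have "sort (j # t) \<in> ?I" if "t \<in> ?T" for t
  proof -
    have t: "length t = k" "set t \<subseteq> {1..n}" "t \<noteq> replicate k j"
      using that by (auto simp: index_tuples_def)
    then obtain i where "i \<in> set t" "i \<noteq> j"
      by (metis replicate_eqI)
    thus ?thesis using t j by (auto simp: offdiag_indices_def index_tuples_def simp del: sort_key_simps)
  qed
  hence img: "(\<lambda>t. sort (j # t)) ` ?T \<subseteq> ?I" by blast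
  have fib: "{t \<in> ?T. sort (j # t) = is} = {t. mset (j # t) = mset is}" if "is \<in> ?I" for "is"
  proof -
    have idx: "is \<in> offdiag_indices (Suc k) n" using that by simp
    have "sort (j # t) = is \<longleftrightarrow> mset (j # t) = mset is" for t
      using offdiag_indicesD(3)[OF idx]
      by (metis mset_sort properties_for_sort sorted_sort_id)
    moreover have "t \<in> ?T" if eq: "mset (j # t) = mset is" for t
    proof -
      have "length (j # t) = length is" "set (j # t) = set is"
        using eq by (metis mset_eq_length, metis mset_eq_setD)
      moreover have "t \<noteq> replicate k j"
      proof
        assume "t = replicate k j"
        hence "set is \<subseteq> {j}" using \<open>set (j # t) = set is\<close> by auto
        thus False using idx by (auto simp: offdiag_indices_def)
      qed
      ultimately show ?thesis using offdiag_indicesD[OF idx] by (auto simp: index_tuples_def)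
    qed
    ultimately show ?thesis by blast
  qed
  have "(\<Sum>t\<in>?T. f (mset (j # t))) = (\<Sum>is\<in>?I. \<Sum>t\<in>{t \<in> ?T. sort (j # t) = is}. f (mset (j # t)))"
    using img by (intro sum.group[symmetric]) (auto simp: finite_index_tuples finite_offdiag_indices)
  also have "\<dots> = (\<Sum>is\<in>?I. slice_count is j * f (mset is))"
  proof (rule sum.cong)
    fix "is" assume idx: "is \<in> ?I"
    have "(\<Sum>t\<in>{t \<in> ?T. sort (j # t) = is}. f (mset (j # t))) = (\<Sum>t\<in>{t. mset (j # t) = mset is}. f (mset is))"
      unfolding fib[OF idx] by (intro sum.cong) auto
    thus "(\<Sum>t\<in>{t \<in> ?T. sort (j # t) = is}. f (mset (j # t))) = slice_count is j * f (mset is)"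
      using card_slice[of j "is"] idx by simp
  qed simp
  finally show ?thesis .
qed

text \<open>
  Multiplying row \<open>j\<close> of the scaled tensor by \<open>d j ^ m\<close> turns every term of the dominance condition
  into a monomial in \<open>d\<close> that no longer depends on \<open>j\<close>.
\<close>

lemma DD_diag_scaling_iff:
  assumes A: "A \<in> symmetric_tensors m n" and m: "m > 0" and d: "\<And>i. i \<in> {1..n} \<Longrightarrow> d i > 0"
  shows "DD m n (diag_scaling m d A) \<longleftrightarrow>
    (\<forall>j\<in>{1..n}. (\<Sum>is \<in> {is \<in> offdiag_indices m n. j \<in> set is}.
        slice_count is j * \<bar>A is\<bar> * monomial {1..n} (count_list is) d) \<le> \<bar>diag_entry m A j\<bar> * d j ^ m)"
proof -
  obtain k where k: "m = Suc k" using m gr0_implies_Suc by blast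
  have row: "(\<Sum>is \<in> index_tuples (m - 1) n - {replicate (m - 1) j}. \<bar>diag_scaling m d A (j # is)\<bar>)
      = (\<Sum>is \<in> {is \<in> offdiag_indices m n. j \<in> set is}.
          slice_count is j * \<bar>A is\<bar> * monomial {1..n} (count_list is) d) / d j ^ m"
    and diag: "\<bar>diag_entry m (diag_scaling m d A) j\<bar> = \<bar>diag_entry m A j\<bar>"
    if j: "j \<in> {1..n}" for j
  proof -
    have dj: "d j > 0" using d j by blast
    have powi: "d j powi (1 - int m) = d j / d j ^ m"
      using dj by (simp add: power_int_diff)
    show "\<bar>diag_entry m (diag_scaling m d A) j\<bar> = \<bar>diag_entry m A j\<bar>"
      unfolding diag_entry_def diag_scaling_def using dj powi k by simp
    define f where "f = (\<lambda>M. \<bar>A (sorted_list_of_multiset M)\<bar> * prod_mset (image_mset d M) / d j ^ m)"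
    have f: "f (mset is) = \<bar>A is\<bar> * monomial {1..n} (count_list is) d / d j ^ m"
      if "is \<in> index_tuples m n" for "is"
    proof -
      have "A (sorted_list_of_multiset (mset is)) = A is"
        by (rule symmetric_tensor_mset_eq[OF A that]) simp
      moreover have "prod_mset (image_mset d (mset is)) = monomial {1..n} (count_list is) d"
        using prod_list_map_count[of "{1..n}" "is" d] that
        by (simp add: monomial_def index_tuples_def prod_mset_prod_list flip: mset_map)
      ultimately show ?thesis by (simp add: f_def)
    qed
    have "(\<Sum>t \<in> index_tuples k n - {replicate k j}. \<bar>diag_scaling m d A (j # t)\<bar>)
        = (\<Sum>t \<in> index_tuples k n - {replicate k j}. f (mset (j # t)))"
    proof (rule sum.cong)
      fix t assume "t \<in> index_tuples k n - {replicate k j}"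
      hence t: "j # t \<in> index_tuples m n" "set t \<subseteq> {1..n}" using k j by (auto simp: index_tuples_def)
      have "prod_list (map d (j # t)) = monomial {1..n} (count_list (j # t)) d"
        unfolding monomial_def using t j by (intro prod_list_map_count) auto
      moreover have "prod_list (map d t) > 0"
        using t(2) d by (induction t) auto
      ultimately show "\<bar>diag_scaling m d A (j # t)\<bar> = f (mset (j # t))"
        unfolding f[OF t(1)] diag_scaling_def using dj powi by (simp add: abs_mult)
    qed simp
    also have "\<dots> = (\<Sum>is \<in> {is \<in> offdiag_indices m n. j \<in> set is}. slice_count is j * f (mset is))"
      using sum_slice[OF j] k by simp
    also have "\<dots> = (\<Sum>is \<in> {is \<in> offdiag_indices m n. j \<in> set is}.
          slice_count is j * \<bar>A is\<bar> * monomial {1..n} (count_list is) d) / d j ^ m"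
      by (simp add: sum_divide_distrib f offdiag_indices_def mult_ac)
    finally show "(\<Sum>is \<in> index_tuples (m - 1) n - {replicate (m - 1) j}. \<bar>diag_scaling m d A (j # is)\<bar>)
      = \<dots>" using k by simp
  qed
  show ?thesis
    unfolding DD_def
  proof (intro ball_cong refl)
    fix j assume j: "j \<in> {1..n}"
    show "(\<Sum>is \<in> index_tuples (m - 1) n - {replicate (m - 1) j}. \<bar>diag_scaling m d A (j # is)\<bar>)
            \<le> \<bar>diag_entry m (diag_scaling m d A) j\<bar> \<longleftrightarrow>
          (\<Sum>is \<in> {is \<in> offdiag_indices m n. j \<in> set is}.
            slice_count is j * \<bar>A is\<bar> * monomial {1..n} (count_list is) d) \<le> \<bar>diag_entry m A j\<bar> * d j ^ m"
      unfolding row[OF j] diag[OF j] using d[OF j] by (simp add: pos_divide_le_eq)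
  qed
qed

section \<open>Power cones and the arithmetic-geometric mean inequality\<close>

lemma index_coeff_eq_prod: "index_coeff is = (\<Prod>k\<in>set is. slice_count is k ^ count_list is k)"
  by (simp add: index_coeff_def slice_count_def)

lemma index_coeff_eq_prod_list: "index_coeff is = prod_list (map (slice_count is) is)"
  by (simp add: index_coeff_eq_prod prod_list_map_count[of "set is"])

lemma index_coeff_pos: "index_coeff is > 0"
  unfolding index_coeff_eq_prod by (simp add: prod_pos slice_count_pos)

text \<open>
  The number of all rearrangements of \<open>is\<close>.
\<close>

definition orbit_size :: "nat list \<Rightarrow> real" where
  "orbit_size is = fact (length is) / (\<Prod>j\<in>set is. fact (count_list is j))"

lemma powr_inverse_eq_root:
  assumes "n > 0" "t \<ge> 0"
  shows "t powr (1 / real n) = root n t"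
  using assms by (cases "t = 0") (simp_all add: root_powr_inverse)

lemma orbit_size_nonneg: "orbit_size is \<ge> 0"
  by (simp add: orbit_size_def prod_nonneg)

text \<open>
  Double counting of the pairs of a rearrangement of \<open>is\<close> and a position that holds \<open>j\<close>.
\<close>

lemma slice_count_orbit_size:
  assumes "j \<in> set is"
  shows "length is * slice_count is j = orbit_size is * count_list is j"
proof -
  let ?P = "\<Prod>i\<in>set is - {j}. fact (count_list is i) :: real"
  have P: "?P > 0" by (intro prod_pos) simp
  obtain k where k: "count_list is j = Suc k"
    using assms by (metis count_list_0_iff not0_implies_Suc)
  obtain l where l: "length is = Suc l"
    using assms by (cases "is") auto
  have "(\<Prod>i\<in>set is. fact (count_list is i - (if i = j then 1 else 0))) = fact k * ?P"
    using assms k by (subst prod.remove[of _ j]) (auto intro!: prod.cong)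
  hence "slice_count is j = fact l / (fact k * ?P)"
    by (simp add: slice_count_def multinomial_def l)
  moreover have "(\<Prod>i\<in>set is. fact (count_list is i)) = fact (Suc k) * ?P"
    using assms k by (subst prod.remove[of _ j]) auto
  hence "orbit_size is = fact (Suc l) / (fact (Suc k) * ?P)"
    by (simp only: orbit_size_def l)
  ultimately show ?thesis
    using P unfolding k l fact_Suc by (simp del: of_nat_Suc)
qed

text \<open>
  The inequality of arithmetic and geometric means, applied over the positions of \<open>is\<close> to the numbers
  \<open>g j * x j ^ m / slice_count is j\<close> with \<open>m = length is\<close>. The power cone condition is exactly what
  bounds their geometric mean below by \<open>\<bar>z\<bar>\<close> times the monomial, and in their arithmetic mean the
  multiplicities turn each \<open>slice_count is j\<close> into \<open>orbit_size is\<close>.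
\<close>

lemma orbit_monomial_le_sum:
  assumes idx: "is \<noteq> []" "set is \<subseteq> V" "finite V"
    and g: "\<And>j. j \<in> set is \<Longrightarrow> g j \<ge> 0" and x: "\<And>j. j \<in> V \<Longrightarrow> x j \<ge> 0"
    and cone: "index_coeff is * \<bar>z\<bar> ^ length is \<le> prod_list (map g is)"
  shows "orbit_size is * \<bar>z\<bar> * monomial V (count_list is) x \<le> (\<Sum>j\<in>set is. g j * x j ^ length is)"
proof -
  let ?m = "length is" and ?X = "monomial V (count_list is) x"
  have m: "?m > 0" using assms(1) by simp
  define y where "y = (\<lambda>j. g j * x j ^ ?m / slice_count is j)"
  have y: "y j \<ge> 0" if "j \<in> set is" for j
    using that g[of j] x[of j] assms(2) slice_count_pos[of "is" j] by (auto simp: y_def)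
  have mul: "prod_list (map (\<lambda>j. f j * h j) js) = prod_list (map f js) * prod_list (map h js)"
    for f h :: "nat \<Rightarrow> real" and js by (induction js) simp_all
  have pow: "prod_list (map (\<lambda>j. x j ^ k) js) = prod_list (map x js) ^ k" for k js
    by (induction js) (simp_all add: power_mult_distrib)
  have X: "prod_list (map x is) = ?X"
    using assms by (simp add: monomial_def prod_list_map_count)
  have X0: "?X \<ge> 0" using x by (simp add: monomial_def prod_nonneg)
  have "index_coeff is * prod_list (map y is) = prod_list (map g is) * prod_list (map (\<lambda>j. x j ^ ?m) is)"
    unfolding index_coeff_eq_prod_list mul[symmetric]
    using slice_count_pos by (intro arg_cong[of _ _ prod_list] map_cong) (auto simp: y_def less_imp_neq[symmetric])
  also have "prod_list (map (\<lambda>j. x j ^ ?m) is) = ?X ^ ?m"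
    unfolding X[symmetric] by (simp add: pow)
  finally have "index_coeff is * prod_list (map y is) \<ge> index_coeff is * \<bar>z\<bar> ^ ?m * ?X ^ ?m"
    using cone X0 by (simp add: mult_right_mono)
  hence "(\<bar>z\<bar> * ?X) ^ ?m \<le> prod_list (map y is)"
    using index_coeff_pos[of "is"] by (simp add: power_mult_distrib mult.assoc)
  also have "prod_list (map y is) = (\<Prod>k<?m. y (is ! k))"
    by (simp add: prod.list_conv_set_nth lessThan_atLeast0)
  finally have "root ?m ((\<bar>z\<bar> * ?X) ^ ?m) \<le> root ?m (\<Prod>k<?m. y (is ! k))"
    using m by simp
  hence "\<bar>z\<bar> * ?X \<le> root ?m (\<Prod>k<?m. y (is ! k))"
    using m X0 by (simp add: real_root_power_cancel)
  also have "\<dots> \<le> (\<Sum>k<?m. y (is ! k)) / ?m"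
  proof -
    have nn: "y (is ! k) \<ge> 0" if "k \<in> {..<?m}" for k using that y by simp
    have "(\<Prod>k<?m. y (is ! k)) powr (1 / real (card {..<?m})) \<le> (\<Sum>k<?m. y (is ! k) / real (card {..<?m}))"
      using idx nn by (intro arith_geom_mean) (auto simp: lessThan_empty_iff)
    moreover have "(\<Prod>k<?m. y (is ! k)) \<ge> 0" using nn by (rule prod_nonneg)
    ultimately show ?thesis
      using powr_inverse_eq_root[OF m] by (simp add: sum_divide_distrib)
  qed
  also have "(\<Sum>k<?m. y (is ! k)) = (\<Sum>j\<in>set is. count_list is j * y j)"
    using sum_list_map_count[of "set is" "is" y]
    by (simp add: sum_list_sum_nth lessThan_atLeast0)
  finally have "orbit_size is * (\<bar>z\<bar> * ?X) \<le> orbit_size is * ((\<Sum>j\<in>set is. count_list is j * y j) / ?m)"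
    using orbit_size_nonneg by (intro mult_left_mono)
  also have "\<dots> = (\<Sum>j\<in>set is. g j * x j ^ ?m)"
    unfolding sum_divide_distrib sum_distrib_left
  proof (intro sum.cong refl)
    fix j assume "j \<in> set is"
    hence "orbit_size is * (count_list is j * y j / ?m) = (?m * slice_count is j) * y j / ?m"
      by (simp add: slice_count_orbit_size)
    also have "\<dots> = g j * x j ^ ?m"
      using m slice_count_pos[of "is" j] by (simp add: y_def)
    finally show "orbit_size is * (count_list is j * y j / ?m) = g j * x j ^ ?m" .
  qed
  finally show ?thesis by (simp add: mult.assoc)
qed

text \<open>
  Taking \<open>m\<close>-th powers removes the fractional exponents from the cone condition.
\<close>

lemma power_cone_uniform_iff:
  assumes "length x = m" "m > 0" "b \<ge> 0"
  shows "(x, b powr (1 / real m) * z) \<in> power_cone (replicate m (1 / real m)) \<longleftrightarrow>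
           (\<forall>t\<in>set x. t \<ge> 0) \<and> b * \<bar>z\<bar> ^ m \<le> prod_list x"
proof (cases "\<forall>t\<in>set x. t \<ge> 0")
  case True
  have root_prod: "root m (\<Prod>k<N. x ! k) = (\<Prod>k<N. root m (x ! k))" for N
    using assms(2) by (induction N) (simp_all add: real_root_mult)
  have nn: "x ! k \<ge> 0" if "k < m" for k using True that assms(1) by simp
  have pl: "prod_list x = (\<Prod>k<m. x ! k)"
    using assms(1) by (simp add: prod.list_conv_set_nth lessThan_atLeast0)
  have pos: "prod_list x \<ge> 0" using True by (simp add: prod_list_nonneg)
  have "(\<Prod>k<length (replicate m (1 / real m)). if replicate m (1 / real m) ! k = 0 then 1
          else (x ! k) powr (replicate m (1 / real m) ! k)) = (\<Prod>k<m. root m (x ! k))"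
    using assms nn by (intro prod.cong) (auto simp: powr_inverse_eq_root)
  also have "\<dots> = root m (prod_list x)"
    unfolding pl by (rule root_prod[symmetric])
  finally have "?thesis \<longleftrightarrow> ((root m b * \<bar>z\<bar> \<le> root m (prod_list x)) = (b * \<bar>z\<bar> ^ m \<le> prod_list x))"
    using assms True by (simp add: power_cone_def powr_inverse_eq_root abs_mult)
  also have "root m b * \<bar>z\<bar> = root m (b * \<bar>z\<bar> ^ m)"
    using assms by (simp add: real_root_mult real_root_power_cancel)
  finally show ?thesis using assms by simp
qed (auto simp: power_cone_def)

section \<open>The characterization\<close>

lemma GDD_plus_iff_scaling:
  assumes "A \<in> symmetric_tensors m n" "m > 0"
  shows "A \<in> GDD_plus m n \<longleftrightarrow> (\<forall>j\<in>{1..n}. diag_entry m A j \<ge> 0) \<and>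
    (\<exists>d. (\<forall>j\<in>{1..n}. d j > 0) \<and>
      (\<forall>j\<in>{1..n}. (\<Sum>is \<in> {is \<in> offdiag_indices m n. j \<in> set is}.
        slice_count is j * \<bar>A is\<bar> * monomial {1..n} (count_list is) d) \<le> diag_entry m A j * d j ^ m))"
proof (cases "\<forall>j\<in>{1..n}. diag_entry m A j \<ge> 0")
  case True
  have "GDD m n A \<longleftrightarrow> (\<exists>d. (\<forall>j\<in>{1..n}. d j > 0) \<and>
      (\<forall>j\<in>{1..n}. (\<Sum>is \<in> {is \<in> offdiag_indices m n. j \<in> set is}.
        slice_count is j * \<bar>A is\<bar> * monomial {1..n} (count_list is) d) \<le> diag_entry m A j * d j ^ m))"
    unfolding GDD_def
  proof (intro arg_cong[of _ _ Ex] ext conj_cong refl)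
    fix d :: "nat \<Rightarrow> real"
    assume "\<forall>j\<in>{1..n}. d j > 0"
    thus "DD m n (diag_scaling m d A) \<longleftrightarrow>
      (\<forall>j\<in>{1..n}. (\<Sum>is \<in> {is \<in> offdiag_indices m n. j \<in> set is}.
        slice_count is j * \<bar>A is\<bar> * monomial {1..n} (count_list is) d) \<le> diag_entry m A j * d j ^ m)"
      using True by (subst DD_diag_scaling_iff[OF assms]) auto
  qed
  thus ?thesis using True assms(1) unfolding GDD_plus_def by blast
qed (auto simp: GDD_plus_def)

lemma feasible_family_of_scaling:
  assumes m: "m > 0" and d: "\<And>j. j \<in> {1..n} \<Longrightarrow> d j > 0"
    and rows: "\<And>j. j \<in> {1..n} \<Longrightarrow> (\<Sum>is \<in> {is \<in> offdiag_indices m n. j \<in> set is}.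
        slice_count is j * \<bar>A is\<bar> * monomial {1..n} (count_list is) d) \<le> diag_entry m A j * d j ^ m"
  shows "feasible_families m n A \<noteq> {}"
proof -
  let ?X = "\<lambda>is. monomial {1..n} (count_list is) d"
  define D where "D = (\<lambda>is \<in> offdiag_indices m n. \<lambda>j \<in> set is. slice_count is j * \<bar>A is\<bar> * ?X is / d j ^ m)"
  have D: "D is j = slice_count is j * \<bar>A is\<bar> * ?X is / d j ^ m"
    if "is \<in> offdiag_indices m n" "j \<in> set is" for "is" j
    using that by (simp add: D_def)
  have "D \<in> (\<Pi>\<^sub>E is \<in> offdiag_indices m n. \<Pi>\<^sub>E j \<in> set is. UNIV)"
    by (auto simp: D_def)
  moreover have "(\<Sum>is \<in> {is \<in> offdiag_indices m n. j \<in> set is}. D is j) \<le> diag_entry m A j"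
    if j: "j \<in> {1..n}" for j
  proof -
    have "(\<Sum>is \<in> {is \<in> offdiag_indices m n. j \<in> set is}. D is j)
        = (\<Sum>is \<in> {is \<in> offdiag_indices m n. j \<in> set is}. slice_count is j * \<bar>A is\<bar> * ?X is) / d j ^ m"
      by (simp add: D sum_divide_distrib)
    thus ?thesis using rows[OF j] d[OF j] by (simp add: pos_divide_le_eq)
  qed
  moreover have "(map (D is) is, index_coeff is powr (1 / real m) * A is) \<in> power_cone (replicate m (1 / real m))"
    if idx: "is \<in> offdiag_indices m n" for "is"
  proof -
    note is_props = offdiag_indicesD[OF idx]
    have dpos: "d j > 0" if "j \<in> set is" for j using d that is_props(2) by blast
    have X: "?X is = prod_list (map d is)"
      unfolding monomial_def using is_props(2) by (intro prod_list_map_count[symmetric]) auto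
    have X0: "?X is > 0" unfolding monomial_def using d by (intro prod_pos) simp
    have cancel: "prod_list (map (\<lambda>j. slice_count is j * b / d j ^ m) js)
        = prod_list (map (slice_count is) js) * b ^ length js / prod_list (map d js) ^ m" for b js
      by (induction js) (simp_all add: power_mult_distrib)
    have "prod_list (map (D is) is) = prod_list (map (\<lambda>j. slice_count is j * (\<bar>A is\<bar> * ?X is) / d j ^ m) is)"
      using D[OF idx] by (intro arg_cong[of _ _ prod_list] map_cong) (auto simp: mult.assoc)
    also have "\<dots> = index_coeff is * (\<bar>A is\<bar> * ?X is) ^ m / ?X is ^ m"
      unfolding cancel by (simp only: index_coeff_eq_prod_list is_props(1) X)
    also have "\<dots> = index_coeff is * \<bar>A is\<bar> ^ m"
      using X0 by (simp add: power_mult_distrib)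
    finally have "index_coeff is * \<bar>A is\<bar> ^ m \<le> prod_list (map (D is) is)" by simp
    moreover have "D is j \<ge> 0" if "j \<in> set is" for j
      using D[OF idx that] dpos[OF that] X0 slice_count_pos[of "is" j] by simp
    ultimately show ?thesis
      using m is_props(1) index_coeff_pos[of "is"] by (subst power_cone_uniform_iff) auto
  qed
  ultimately have "D \<in> feasible_families m n A"
    unfolding feasible_families_def by blast
  thus ?thesis by blast
qed

text \<open>
  The bounds on the single monomials add up because the row conditions on \<open>d\<close> are exactly what
  appears when the summation over indices and the summation over their entries are exchanged.
\<close>

lemma comparison_form_nonneg:
  assumes m: "m > 0"
    and sums: "\<And>j. j \<in> {1..n} \<Longrightarrow> (\<Sum>is \<in> {is \<in> offdiag_indices m n. j \<in> set is}. d is j) \<le> a j"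
    and nn: "\<And>is j. is \<in> offdiag_indices m n \<Longrightarrow> j \<in> set is \<Longrightarrow> d is j \<ge> 0"
    and cone: "\<And>is. is \<in> offdiag_indices m n \<Longrightarrow> index_coeff is * \<bar>A is\<bar> ^ m \<le> prod_list (map (d is) is)"
    and x: "\<And>j. j \<in> {1..n} \<Longrightarrow> x j \<ge> 0"
  shows "diag_minus_tail {1..n} (offdiag_indices m n) m a (\<lambda>is. orbit_size is * \<bar>A is\<bar>) count_list x \<ge> 0"
proof -
  let ?E = "offdiag_indices m n"
  have "(\<Sum>is\<in>?E. orbit_size is * \<bar>A is\<bar> * monomial {1..n} (count_list is) x)
      \<le> (\<Sum>is\<in>?E. \<Sum>j\<in>set is. d is j * x j ^ m)"
  proof (rule sum_mono)
    fix "is" assume idx: "is \<in> ?E"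
    note is_props = offdiag_indicesD[OF idx]
    have "is \<noteq> []" using is_props(1) m by auto
    thus "orbit_size is * \<bar>A is\<bar> * monomial {1..n} (count_list is) x \<le> (\<Sum>j\<in>set is. d is j * x j ^ m)"
      using orbit_monomial_le_sum[of "is" "{1..n}" "d is" x "A is"] is_props nn[OF idx] cone[OF idx] x
      by simp
  qed
  also have "\<dots> = (\<Sum>is\<in>?E. \<Sum>j\<in>{j\<in>{1..n}. j \<in> set is}. d is j * x j ^ m)"
  proof (intro sum.cong refl)
    fix "is" assume "is \<in> ?E"
    from offdiag_indicesD(2)[OF this] show "set is = {j\<in>{1..n}. j \<in> set is}" by blast
  qed
  also have "\<dots> = (\<Sum>j\<in>{1..n}. \<Sum>is\<in>{is\<in>?E. j \<in> set is}. d is j * x j ^ m)"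
    by (rule sum.swap_restrict) (simp_all add: finite_offdiag_indices)
  also have "\<dots> \<le> (\<Sum>j\<in>{1..n}. a j * x j ^ m)"
    unfolding sum_distrib_right[symmetric]
    using sums x by (intro sum_mono mult_right_mono) auto
  finally show ?thesis by (simp add: diag_minus_tail_def)
qed

text \<open>
  Each coefficient of the form collects the whole orbit of an index. Its derivative in direction \<open>j\<close>
  brings down a multiplicity, and \<open>slice_count_orbit_size\<close> turns that product into \<open>m\<close> times the
  coefficient in row \<open>j\<close> of the scaled tensor.
\<close>

lemma scaling_of_feasible_family:
  assumes A: "A \<in> symmetric_tensors m n" and m: "m > 0" and D: "d \<in> feasible_families m n A"
  shows "A \<in> GDD_plus m n"
proof -
  let ?E = "offdiag_indices m n" and ?X = "\<lambda>x is. monomial {1..n} (count_list is) x"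
  have sums: "(\<Sum>is \<in> {is \<in> ?E. j \<in> set is}. d is j) \<le> diag_entry m A j" if "j \<in> {1..n}" for j
    using D that unfolding feasible_families_def by blast
  have cone: "(\<forall>t\<in>set (map (d is) is). t \<ge> 0) \<and> index_coeff is * \<bar>A is\<bar> ^ m \<le> prod_list (map (d is) is)"
    if idx: "is \<in> ?E" for "is"
  proof (subst power_cone_uniform_iff[symmetric])
    show "(map (d is) is, index_coeff is powr (1 / real m) * A is) \<in> power_cone (replicate m (1 / real m))"
      using D idx unfolding feasible_families_def by blast
  qed (use m offdiag_indicesD(1)[OF idx] index_coeff_pos[of "is"] in auto)
  hence nn: "d is j \<ge> 0" if "is \<in> ?E" "j \<in> set is" for "is" j
    using that by auto
  have diag: "diag_entry m A j \<ge> 0" if "j \<in> {1..n}" for j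
    by (rule order_trans[OF sum_nonneg sums[OF that]]) (use nn in auto)
  have "\<exists>x. (\<forall>j\<in>{1..n}. x j > 0) \<and>
     (\<forall>j\<in>{1..n}. (\<Sum>is\<in>?E. orbit_size is * \<bar>A is\<bar> * count_list is j * ?X x is) \<le> m * diag_entry m A j * x j ^ m)"
  proof (rule positive_scaling_exists)
    show "sum (count_list is) {1..n} = m" if "is \<in> ?E" for "is"
      using offdiag_indicesD[OF that] by (simp add: sum_count_set)
    show "0 \<le> orbit_size is * \<bar>A is\<bar>" for "is"
      by (simp add: orbit_size_nonneg)
    show "diag_minus_tail {1..n} ?E m (diag_entry m A) (\<lambda>is. orbit_size is * \<bar>A is\<bar>) count_list x \<ge> 0"
      if "\<And>j. j \<in> {1..n} \<Longrightarrow> x j \<ge> 0" for x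
      by (rule comparison_form_nonneg[OF m sums nn _ that]) (use cone in auto)
  qed (simp_all add: m finite_offdiag_indices)
  then obtain x where x: "\<forall>j\<in>{1..n}. x j > 0"
    "\<And>j. j \<in> {1..n} \<Longrightarrow>
       (\<Sum>is\<in>?E. orbit_size is * \<bar>A is\<bar> * count_list is j * ?X x is) \<le> m * diag_entry m A j * x j ^ m"
    by blast
  have "(\<Sum>is \<in> {is \<in> ?E. j \<in> set is}. slice_count is j * \<bar>A is\<bar> * ?X x is) \<le> diag_entry m A j * x j ^ m"
    if j: "j \<in> {1..n}" for j
  proof -
    have "m * (\<Sum>is \<in> {is \<in> ?E. j \<in> set is}. slice_count is j * \<bar>A is\<bar> * ?X x is)
        = (\<Sum>is\<in>?E. orbit_size is * \<bar>A is\<bar> * count_list is j * ?X x is)"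
      unfolding sum_distrib_left
    proof (rule sum.mono_neutral_cong_left)
      fix "is" assume "is \<in> {is \<in> ?E. j \<in> set is}"
      hence "m * slice_count is j = orbit_size is * count_list is j"
        using slice_count_orbit_size[of j "is"] offdiag_indicesD(1)[of "is" m n] by simp
      thus "m * (slice_count is j * \<bar>A is\<bar> * ?X x is) = orbit_size is * \<bar>A is\<bar> * count_list is j * ?X x is"
        by (metis mult.assoc mult.commute)
    qed (auto simp: finite_offdiag_indices)
    also have "\<dots> \<le> m * (diag_entry m A j * x j ^ m)"
      using x(2)[OF j] by (simp add: mult.assoc)
    finally show ?thesis using m by simp
  qed
  thus ?thesis using x(1) diag unfolding GDD_plus_iff_scaling[OF A m] by blast
qed

theorem corollary3:
  fixes m n :: nat and A :: "nat list \<Rightarrow> real"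
  assumes "A \<in> symmetric_tensors m n"
  shows "A \<in> GDD_plus m n \<longleftrightarrow> feasible_families m n A \<noteq> {}"
proof (cases "m = 0")
  case True
  \<comment> \<open>The only index is the empty list, so both sides say that the diagonal entries are nonnegative.\<close>
  have "offdiag_indices m n = {}" "index_tuples (m - 1) n = {[]}"
    using True by (auto simp: offdiag_indices_def index_tuples_def)
  moreover from this have "GDD m n A"
    using True by (auto simp: GDD_def DD_def intro!: exI[of _ "\<lambda>_. 1"])
  ultimately show ?thesis
    using assms by (auto simp: GDD_plus_def feasible_families_def)
next
  case False
  hence m: "m > 0" by simp
  show ?thesis
  proof
    assume "A \<in> GDD_plus m n"
    then obtain d where "\<forall>j\<in>{1..n}. d j > 0"
      "\<forall>j\<in>{1..n}. (\<Sum>is \<in> {is \<in> offdiag_indices m n. j \<in> set is}.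
        slice_count is j * \<bar>A is\<bar> * monomial {1..n} (count_list is) d) \<le> diag_entry m A j * d j ^ m"
      unfolding GDD_plus_iff_scaling[OF assms m] by blast
    thus "feasible_families m n A \<noteq> {}"
      using m by (intro feasible_family_of_scaling[of m n d]) auto
  next
    assume "feasible_families m n A \<noteq> {}"
    thus "A \<in> GDD_plus m n"
      using scaling_of_feasible_family[OF assms m] by blast
  qed
qed

end
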